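(* Let $L$ be a (finite-dimensional) complex nilpotent left Leibniz algebra with one-dimensional commutator ideal $[L,L]=\mathbb{C}z$, such that $L\not\cong \mathfrak{l}_{2n+1}^{J_{1}}$, $L\not\cong \mathfrak{l}_{2n+1}^{J_{-1}}$ and $L\not\cong\mathfrak{d}_n$ for every integer $n\ge 1$. Then every almost inner derivation $d$ of $L$ is an inner derivation of $L$.
   Context: A left Leibniz algebra over a field $\mathbb{F}$ is a vector space $L$ with a bilinear bracket $[-,-]\colon L\times L\to L$ satisfying $[x,[y,z]]=[[x,y],z]+[y,[x,z]]$ for all $x,y,z\in L$. All algebras are finite-dimensional. The lower central series is $L^{(0)}=L$, $L^{(k+1)}=[L,L^{(k)}]$ (so $L^{(1)}=[L,L]$), and $L$ is nilpotent if $L^{(n)}=0$ for some $n$. A derivation of $L$ is a linear map $d\colon L\to L$ with $d([x,y])=[d(x),y]+[x,d(y)]$ for all $x,y$. An inner derivation is a map of the form $\operatorname{ad}_x=[x,-]$, $x\in L$. A derivation $d$ is almost inner if $d(x)\in[L,x]=\{[y,x] : y\in L\}$ for every $x\in L$. For $a\in\mathbb{C}$ and $n\ge 1$, the Heisenberg Leibniz algebra $\mathfrak{l}_{2n+1}^{J_a}$ is the complex algebra with basis $\{e_1,\dots,e_n,f_1,\dots,f_n,z\}$ and nonzero brackets of basis elements $[e_i,f_i]=(1+a)z$, $[f_i,e_i]=(-1+a)z$ for $i=1,\dots,n$, and $[e_i,f_{i-1}]=[f_{i-1},e_i]=z$ for $i=2,\dots,n$. For $n\ge 1$, the Dieudonné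 Leibniz algebra $\mathfrak{d}_n$ is the $(2n+2)$-dimensional algebra with basis $\{e_1,\dots,e_{2n+1},z\}$ and nonzero brackets of basis elements $[e_1,e_{n+2}]=z$; $[e_i,e_{n+i}]=[e_i,e_{n+i+1}]=z$ for $i=2,\dots,n$; $[e_{n+1},e_{2n+1}]=z$; and $[e_i,e_{i-n}]=z$, $[e_i,e_{i-n-1}]=-z$ for $i=n+2,\dots,2n+1$. *)

theory Defs
  imports Complex_Main "HOL-Library.Function_Algebras"
begin

locale left_leibniz_algebra = vector_space scale
  for scale :: "'k::field \<Rightarrow> 'a::ab_group_add \<Rightarrow> 'a" +
  fixes bracket :: "'a \<Rightarrow> 'a \<Rightarrow> 'a"
  assumes linear_left: "Vector_Spaces.linear scale scale (\<lambda>x. bracket x y)"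
    and linear_right: "Vector_Spaces.linear scale scale (\<lambda>y. bracket x y)"
    and left_leibniz:
      "bracket x (bracket y z) = bracket (bracket x y) z + bracket y (bracket x z)"
begin

definition bracket_span :: "'a set \<Rightarrow> 'a set \<Rightarrow> 'a set" where
  "bracket_span A B = span {bracket x y | x y. x \<in> A \<and> y \<in> B}"

fun lower_central :: "nat \<Rightarrow> 'a set" where
  "lower_central 0 = UNIV"
| "lower_central (Suc k) = bracket_span UNIV (lower_central k)"

definition nilpotent :: bool where
  "nilpotent \<longleftrightarrow> (\<exists>n. lower_central n = {0})"

definition derivation :: "('a \<Rightarrow> 'a) \<Rightarrow> bool" where
  "derivation d \<longleftrightarrow> Vector_Spaces.linear scale scale d \<and>
     (\<forall>x y. d (bracket x y) = bracket (d x) y + bracket x (d y))"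

definition inner_derivation :: "('a \<Rightarrow> 'a) \<Rightarrow> bool" where
  "inner_derivation d \<longleftrightarrow> (\<exists>x. d = (\<lambda>y. bracket x y))"

definition almost_inner_derivation :: "('a \<Rightarrow> 'a) \<Rightarrow> bool" where
  "almost_inner_derivation d \<longleftrightarrow> derivation d \<and> (\<forall>x. d x \<in> {bracket y x | y. True})"

text \<open>
  The dimension of the algebras defined below depends on a natural number, so they live on
  subspaces of a function space. Accordingly, the target of an isomorphism is given
  by a scalar multiplication, a carrier \<open>V\<close> inside the target type, and a bracket.
\<close>

definition isomorphic_to ::
    "('k \<Rightarrow> 'b::ab_group_add \<Rightarrow> 'b) \<Rightarrow> 'b set \<Rightarrow> ('b \<Rightarrow> 'b \<Rightarrow> 'b) \<Rightarrow> bool" where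
  "isomorphic_to scale' V bracket' \<longleftrightarrow>
     (\<exists>h. Vector_Spaces.linear scale scale' h \<and> bij_betw h UNIV V \<and>
          (\<forall>x y. h (bracket x y) = bracket' (h x) (h y)))"

end

definition coord_scale :: "complex \<Rightarrow> ('i \<Rightarrow> complex) \<Rightarrow> 'i \<Rightarrow> complex" where
  "coord_scale c v = (\<lambda>i. c * v i)"

definition coord_space :: "'i set \<Rightarrow> ('i \<Rightarrow> complex) set" where
  "coord_space I = {v. \<forall>i. i \<notin> I \<longrightarrow> v i = 0}"

text \<open>
  The bilinear extension of the rule that the bracket of the basis vectors with
  indices \<open>i\<close> and \<open>j\<close> is \<open>c i j\<close> times the basis vector with index \<open>\<zeta>\<close>.
\<close>

definition coord_bracket ::
    "'i set \<Rightarrow> 'i \<Rightarrow> ('i \<Rightarrow> 'i \<Rightarrow> complex) \<Rightarrow> ('i \<Rightarrow> complex) \<Rightarrow> ('i \<Rightarrow> complex) \<Rightarrow> 'i \<Rightarrow> complex" where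
  "coord_bracket I \<zeta> c v w = (\<lambda>k. if k = \<zeta> then \<Sum>i\<in>I. \<Sum>j\<in>I. v i * w j * c i j else 0)"

lemma vector_space_coord_scale: "vector_space coord_scale"
  by unfold_locales (auto simp: coord_scale_def fun_eq_iff algebra_simps)

lemma subspace_coord_space: "module.subspace coord_scale (coord_space I)"
proof -
  interpret vector_space coord_scale by (rule vector_space_coord_scale)
  show ?thesis by (auto simp: subspace_def coord_space_def coord_scale_def)
qed

datatype heisenberg_index = HE nat | HF nat | HZ

definition heisenberg_basis :: "nat \<Rightarrow> heisenberg_index set" where
  "heisenberg_basis n = HE ` {1..n} \<union> HF ` {1..n} \<union> {HZ}"

fun heisenberg_coeff :: "complex \<Rightarrow> heisenberg_index \<Rightarrow> heisenberg_index \<Rightarrow> complex" where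
  "heisenberg_coeff a (HE i) (HF j) = (if i = j then 1 + a else if i = j + 1 then 1 else 0)"
| "heisenberg_coeff a (HF j) (HE i) = (if i = j then - 1 + a else if i = j + 1 then 1 else 0)"
| "heisenberg_coeff a _ _ = 0"

abbreviation heisenberg_space :: "nat \<Rightarrow> (heisenberg_index \<Rightarrow> complex) set" where
  "heisenberg_space n \<equiv> coord_space (heisenberg_basis n)"

abbreviation heisenberg_bracket ::
    "nat \<Rightarrow> complex \<Rightarrow> (heisenberg_index \<Rightarrow> complex) \<Rightarrow> (heisenberg_index \<Rightarrow> complex) \<Rightarrow>
     heisenberg_index \<Rightarrow> complex" where
  "heisenberg_bracket n a \<equiv> coord_bracket (heisenberg_basis n) HZ (heisenberg_coeff a)"

datatype dieudonne_index = DE nat | DZ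

definition dieudonne_basis :: "nat \<Rightarrow> dieudonne_index set" where
  "dieudonne_basis n = DE ` {1..2 * n + 1} \<union> {DZ}"

fun dieudonne_coeff :: "nat \<Rightarrow> dieudonne_index \<Rightarrow> dieudonne_index \<Rightarrow> complex" where
  "dieudonne_coeff n (DE i) (DE j) =
     (if i = 1 \<and> j = n + 2 then 1
      else if i \<in> {2..n} \<and> (j = n + i \<or> j = n + i + 1) then 1
      else if i = n + 1 \<and> j = 2 * n + 1 then 1
      else if i \<in> {n + 2..2 * n + 1} \<and> j = i - n then 1
      else if i \<in> {n + 2..2 * n + 1} \<and> j = i - n - 1 then - 1
      else 0)"
| "dieudonne_coeff n _ _ = 0"

abbreviation dieudonne_space :: "nat \<Rightarrow> (dieudonne_index \<Rightarrow> complex) set" where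
  "dieudonne_space n \<equiv> coord_space (dieudonne_basis n)"

abbreviation dieudonne_bracket ::
    "nat \<Rightarrow> (dieudonne_index \<Rightarrow> complex) \<Rightarrow> (dieudonne_index \<Rightarrow> complex) \<Rightarrow>
     dieudonne_index \<Rightarrow> complex" where
  "dieudonne_bracket n \<equiv> coord_bracket (dieudonne_basis n) DZ (dieudonne_coeff n)"

end

theory Submission
  imports Defs
begin

text \<open>
  Since all brackets lie on the line through \<open>z\<close>, the algebra is encoded by a scalar-valued
  bilinear form \<open>\<beta>\<close> with \<open>[x,y] = \<beta>(x,y) z\<close>. The value of an almost inner derivation at \<open>x\<close> is
  itself a bracket, so it has the form \<open>\<phi>(x) z\<close> with a linear functional \<open>\<phi>\<close>, and \<open>\<phi>\<close> vanishes on
  the right radical \<open>{x. \<forall>y. \<beta>(y,x) = 0}\<close>. Being inner means that \<open>\<phi> = \<beta>(y,-)\<close> for some \<open>y\<close>.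

  The right radical is the common kernel of the functionals \<open>\<beta>(b,-)\<close>, where \<open>b\<close> runs through a
  finite basis. A functional that vanishes on the common kernel of finitely many functionals is a
  linear combination of them (lemma \<open>functional_in_span\<close>), so
  \<open>\<phi> = (\<Sum>b. c\<^sub>b \<beta>(b,-)) = \<beta>(\<Sum>b. c\<^sub>b b, -)\<close>. In other words, a pointwise choice of the inner
  derivation can always be made globally, because one scalar-valued functional is all that has to
  be matched.
\<close>

text \<open>
  Duality between subspaces and functionals, in a form that leaves the dimension of the space
  arbitrary because only the family of functionals has to be finite. By induction on the family:
  modulo a multiple of one functional, \<open>\<phi>\<close> is controlled by the others.
\<close>

lemma (in vector_space) functional_in_span:
  assumes "finite S"
    and "\<And>i. i \<in> S \<Longrightarrow> Vector_Spaces.linear scale (*) (f i)"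
    and "Vector_Spaces.linear scale (*) \<phi>"
    and "\<And>x. (\<And>i. i \<in> S \<Longrightarrow> f i x = 0) \<Longrightarrow> \<phi> x = 0"
  shows "\<exists>c. \<forall>x. \<phi> x = (\<Sum>i\<in>S. c i * f i x)"
  using assms
proof (induction S arbitrary: \<phi> rule: finite_induct)
  case empty
  then show ?case by simp
next
  case (insert j S)
  note hom_simps = module_hom.add module_hom.diff module_hom.scale
  have fj: "module_hom scale (*) (f j)"
    using insert.prems(1) by (simp add: module_hom_iff_linear)
  have \<phi>: "module_hom scale (*) \<phi>"
    using insert.prems(2) by (simp add: module_hom_iff_linear)
  have fi: "module_hom scale (*) (f i)" if "i \<in> S" for i
    using insert.prems(1) that by (simp add: module_hom_iff_linear)
  \<comment> \<open>Subtracting a suitable multiple of \<open>f j\<close> from \<open>\<phi>\<close> makes it vanish on the common kernel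
    of the family indexed by \<open>S\<close>. If \<open>f j\<close> vanishes there, the multiple \<open>0\<close> works; otherwise the
    factor is the value of \<open>\<phi>\<close> at a point of that kernel where \<open>f j\<close> is \<open>1\<close>.\<close>
  obtain a where a: "\<phi> x - a * f j x = 0" if "\<And>i. i \<in> S \<Longrightarrow> f i x = 0" for x
  proof (cases "\<exists>v. (\<forall>i\<in>S. f i v = 0) \<and> f j v \<noteq> 0")
    case False
    then show thesis using that[of 0] insert.prems(3) by auto
  next
    case True
    then obtain v where v: "\<And>i. i \<in> S \<Longrightarrow> f i v = 0" "f j v \<noteq> 0" by blast
    define u where "u = scale (1 / f j v) v"
    have fu: "f i u = 0" if "i \<in> S" for i
      using v(1)[OF that] by (simp add: u_def module_hom.scale[OF fi[OF that]])
    have fju: "f j u = 1" using v(2) by (simp add: u_def module_hom.scale[OF fj])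
    have "\<phi> x - \<phi> u * f j x = 0" if x: "\<And>i. i \<in> S \<Longrightarrow> f i x = 0" for x
    proof -
      have "\<phi> (x - scale (f j x) u) = 0"
      proof (rule insert.prems(3))
        fix i assume "i \<in> insert j S"
        then show "f i (x - scale (f j x) u) = 0"
        proof
          assume "i = j"
          then show ?thesis by (simp add: hom_simps[OF fj] fju)
        next
          assume i: "i \<in> S"
          show ?thesis by (simp add: hom_simps[OF fi[OF i]] x[OF i] fu[OF i])
        qed
      qed
      then show ?thesis by (simp add: hom_simps[OF \<phi>] mult.commute)
    qed
    then show thesis by (rule that)
  qed
  have "Vector_Spaces.linear scale (*) (\<lambda>x. \<phi> x - a * f j x)"
    unfolding Vector_Spaces.linear_iff
  proof (intro conjI allI)
    show "vector_space scale" "vector_space ((*) :: 'a \<Rightarrow> 'a \<Rightarrow> 'a)"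
      using insert.prems(2) by (simp_all only: Vector_Spaces.linear_iff)
    show "\<phi> (x + y) - a * f j (x + y) = \<phi> x - a * f j x + (\<phi> y - a * f j y)" for x y
      by (simp add: hom_simps(1)[OF \<phi>] hom_simps(1)[OF fj] distrib_left)
    show "\<phi> (scale r x) - a * f j (scale r x) = r * (\<phi> x - a * f j x)" for r x
      by (simp add: hom_simps(3)[OF \<phi>] hom_simps(3)[OF fj] right_diff_distrib mult.left_commute)
  qed
  with insert.IH[of "\<lambda>x. \<phi> x - a * f j x"] insert.prems(1) a
  obtain c where c: "\<forall>x. \<phi> x - a * f j x = (\<Sum>i\<in>S. c i * f i x)"
    by blast
  have "\<phi> x = (\<Sum>i\<in>insert j S. (c(j := a)) i * f i x)" for x
  proof -
    have "(\<Sum>i\<in>S. (c(j := a)) i * f i x) = (\<Sum>i\<in>S. c i * f i x)"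
      using insert.hyps(2) by (intro sum.cong) auto
    then show ?thesis using c[rule_format, of x] insert.hyps
      by (simp add: algebra_simps)
  qed
  then show ?case by blast
qed

text \<open>
  This is where the two notions meet: the inner derivations, read as functionals, form the span of
  the \<open>\<beta>(b,-)\<close>, and the almost inner ones are functionals vanishing on the common kernel of that
  family.
\<close>

lemma (in left_leibniz_algebra) almost_inner_derivation_imp_inner:
  assumes "finite_dimensional_vector_space scale Basis"
    and z: "z \<noteq> 0"
    and comm: "bracket_span UNIV UNIV = span {z}"
    and d: "almost_inner_derivation d"
  shows "inner_derivation d"
proof -
  interpret fd: finite_dimensional_vector_space scale Basis by fact
  interpret d: Vector_Spaces.linear scale scale d
    using d by (simp add: almost_inner_derivation_def derivation_def)
  have "bracket x y \<in> span {z}" for x y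
    unfolding comm[symmetric] bracket_span_def by (intro span_base) blast
  then have "\<exists>c. bracket x y = scale c z" for x y
    by (auto simp: span_singleton)
  then obtain \<beta> where \<beta>: "\<And>x y. bracket x y = scale (\<beta> x y) z"
    by metis
  have ad_value: "\<exists>y. d x = bracket y x" for x
    using d unfolding almost_inner_derivation_def by blast
  then have "\<exists>c. d x = scale c z" for x
    using \<beta> by metis
  then obtain \<phi> where \<phi>: "\<And>x. d x = scale (\<phi> x) z"
    by metis
  have cancel: "a = b" if "scale a z = scale b z" for a b
    using that z by (simp add: scale_cancel_right)
  have scalar_space: "vector_space ((*) :: 'k \<Rightarrow> 'k \<Rightarrow> 'k)"
    by unfold_locales (simp_all add: algebra_simps)
  have lin_\<beta>: "Vector_Spaces.linear scale (*) (\<beta> y)" for y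
  proof -
    interpret ad: Vector_Spaces.linear scale scale "bracket y" by (rule linear_right)
    have "\<beta> y (u + v) = \<beta> y u + \<beta> y v" for u v
      by (rule cancel) (use ad.add[of u v] in \<open>simp only: \<beta> scale_left_distrib\<close>)
    moreover have "\<beta> y (scale r u) = r * \<beta> y u" for r u
      by (rule cancel) (use ad.scale[of r u] in \<open>simp only: \<beta> scale_scale\<close>)
    ultimately show ?thesis
      using scalar_space vector_space_axioms by (simp only: Vector_Spaces.linear_iff) blast
  qed
  have lin_\<phi>: "Vector_Spaces.linear scale (*) \<phi>"
  proof -
    have "\<phi> (u + v) = \<phi> u + \<phi> v" for u v
      by (rule cancel) (use d.add[of u v] in \<open>simp only: \<phi> scale_left_distrib\<close>)
    moreover have "\<phi> (scale r u) = r * \<phi> u" for r u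
      by (rule cancel) (use d.scale[of r u] in \<open>simp only: \<phi> scale_scale\<close>)
    ultimately show ?thesis
      using scalar_space vector_space_axioms by (simp only: Vector_Spaces.linear_iff) blast
  qed
  \<comment> \<open>A vector killed on the left by a basis is killed by every \<open>y\<close>, in particular by the \<open>y\<close>
    that realises \<open>d x = [y,x]\<close>.\<close>
  have kernel: "\<phi> x = 0" if x: "\<And>b. b \<in> Basis \<Longrightarrow> \<beta> b x = 0" for x
  proof -
    interpret left: Vector_Spaces.linear scale scale "\<lambda>y. bracket y x" by (rule linear_left)
    obtain y where y: "d x = bracket y x"
      using ad_value by blast
    have "bracket b x = 0" if "b \<in> Basis" for b
      by (simp only: \<beta> x[OF that] scale_zero_left)
    moreover have "y \<in> span Basis"
      by (simp only: fd.span_Basis UNIV_I)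
    ultimately have "bracket y x = 0"
      by (rule left.eq_0_on_span)
    then have "scale (\<phi> x) z = 0"
      by (simp only: y flip: \<phi>)
    then show ?thesis
      using z by (simp only: scale_eq_0_iff) blast
  qed
  have "\<exists>c. \<forall>x. \<phi> x = (\<Sum>b\<in>Basis. c b * \<beta> b x)"
    by (rule functional_in_span[OF fd.finite_Basis lin_\<beta> lin_\<phi> kernel])
  then obtain c where c: "\<And>x. \<phi> x = (\<Sum>b\<in>Basis. c b * \<beta> b x)"
    by blast
  have "d x = bracket (\<Sum>b\<in>Basis. scale (c b) b) x" for x
  proof -
    interpret left: Vector_Spaces.linear scale scale "\<lambda>y. bracket y x" by (rule linear_left)
    have "bracket (\<Sum>b\<in>Basis. scale (c b) b) x = (\<Sum>b\<in>Basis. scale (c b) (bracket b x))"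
      by (simp only: left.sum left.scale)
    also have "\<dots> = scale (\<Sum>b\<in>Basis. c b * \<beta> b x) z"
      by (simp only: \<beta> scale_sum_left scale_scale)
    also have "\<dots> = d x"
      by (simp only: \<phi> c)
    finally show ?thesis ..
  qed
  then show ?thesis unfolding inner_derivation_def by blast
qed

theorem proposition5p1:
  fixes scale :: "complex \<Rightarrow> 'a::ab_group_add \<Rightarrow> 'a"
    and bracket :: "'a \<Rightarrow> 'a \<Rightarrow> 'a"
    and Basis :: "'a set"
    and z :: 'a
    and d :: "'a \<Rightarrow> 'a"
  assumes "finite_dimensional_vector_space scale Basis"
    and "left_leibniz_algebra scale bracket"
    and "left_leibniz_algebra.nilpotent scale bracket"
    and "z \<noteq> 0"
    and "left_leibniz_algebra.bracket_span scale bracket UNIV UNIV = module.span scale {z}"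
    and "\<And>n. n \<ge> 1 \<Longrightarrow> \<not> left_leibniz_algebra.isomorphic_to scale bracket
           coord_scale (heisenberg_space n) (heisenberg_bracket n 1)"
    and "\<And>n. n \<ge> 1 \<Longrightarrow> \<not> left_leibniz_algebra.isomorphic_to scale bracket
           coord_scale (heisenberg_space n) (heisenberg_bracket n (- 1))"
    and "\<And>n. n \<ge> 1 \<Longrightarrow> \<not> left_leibniz_algebra.isomorphic_to scale bracket
           coord_scale (dieudonne_space n) (dieudonne_bracket n)"
    and "left_leibniz_algebra.almost_inner_derivation scale bracket d"
  shows "left_leibniz_algebra.inner_derivation bracket d"
  using left_leibniz_algebra.almost_inner_derivation_imp_inner[OF assms(2,1,4,5,9)] .

end
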